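(* Let $f,g:X\to Y$ be $(\kappa,\lambda)$-homotopic maps from a digital image $(X,\kappa)$ to a digital image $(Y,\lambda)$. Then $f$ and $g$ induce the same maps on homology groups, i.e. $f_*=g_*:dH_n(X)\to dH_n(Y)$ for every $n$.
   Context: A digital image $(X,\kappa)$ is a finite subset $X\subset\mathbb{Z}^d$ ($d\ge 1$) equipped with an adjacency relation $\kappa=c_l$ for some $1\le l\le d$, where distinct points $p,q\in\mathbb{Z}^d$ are $c_l$-adjacent if at most $l$ of their coordinates differ by one unit and all remaining coordinates are equal. For integers $a<b$, $[a,b]_{\mathbb{Z}}=\{a,\dots,b\}$ with the adjacency $c_1$ of $\mathbb{Z}$ (denoted $2$). A function $f:(X,\kappa)\to(Y,\lambda)$ is $(\kappa,\lambda)$-continuous if whenever $x_0,x_1$ are $\kappa$-adjacent, $f(x_0),f(x_1)$ are equal or $\lambda$-adjacent. $(\kappa,\lambda)$-continuous functions $f,g:X\to Y$ are $(\kappa,\lambda)$-homotopic if there are a positive integer $m$ and a function $H:[0,m]_{\mathbb{Z}}\times X\to Y$ with $H(0,x)=f(x)$ and $H(m,x)=g(x)$ for all $x\in X$, such that for every $x\in X$ the function $t\mapsto H(t,x)$ is $(2,\lambda)$-continuous, and for every $t\in[0,m]_{\mathbb{Z}}$ the function $x\mapsto H(t,x)$ is $(\kappa,\lambda)$-continuous. Cubical singular homology. $I=[0,1]_{\mathbb{Z}}$, and $I^n$ carries the $c_1$-adjacency of $\mathbb{Z}^n$ (denoted $2n$); $I^0$ is a point. A digital $n$-cube in $(X,\kappa)$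 is a $(2n,\kappa)$-continuous map $T:I^n\to X$; it is degenerate if for some $i$, $T(t_1,\dots,t_n)$ does not depend on $t_i$. $dQ_n(X)$ is the free abelian group on digital $n$-cubes, $dD_n(X)$ the subgroup generated by degenerate ones, $dC_n(X)=dQ_n(X)/dD_n(X)$ (zero for $n<0$). Put $A_iT(t_1,\dots,t_{n-1})=T(t_1,\dots,t_{i-1},0,t_i,\dots,t_{n-1})$, $B_iT(t_1,\dots,t_{n-1})=T(t_1,\dots,t_{i-1},1,t_i,\dots,t_{n-1})$, $\partial_n T=\sum_{i=1}^n(-1)^i(A_iT-B_iT)$ (with $\partial_n=0$ for $n\le0$); this induces a boundary map on $dC_\bullet(X)$ with $\partial\partial=0$, and $dH_n(X)=\ker\partial_n/\operatorname{im}\partial_{n+1}$ is the homology of $(dC_\bullet(X),\partial)$. A $(\kappa,\lambda)$-continuous $f:X\to Y$ induces a chain map $f_\#:dC_n(X)\to dC_n(Y)$, $T\mapsto f\circ T$, and hence $f_*:dH_n(X)\to dH_n(Y)$. *)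

theory Defs
  imports "HOL-Algebra.Free_Abelian_Groups" "HOL-Algebra.Generated_Groups"
begin

section \<open>Digital images and digital homotopy\<close>

text \<open>The dimension \<open>n\<close> of a cube varies inside the homology construction, so the points of
  \<open>\<int>\<^sup>d\<close> are integer lists of length \<open>d\<close>.\<close>

definition int_lattice :: "nat \<Rightarrow> int list set"
  where "int_lattice d = {p. length p = d}"

definition c_adj :: "nat \<Rightarrow> nat \<Rightarrow> int list \<Rightarrow> int list \<Rightarrow> bool"
  where "c_adj d l p q \<longleftrightarrow> p \<in> int_lattice d \<and> q \<in> int_lattice d \<and> p \<noteq> q \<and>
    card {i. i < d \<and> \<bar>p ! i - q ! i\<bar> = 1} \<le> l \<and>
    (\<forall>i<d. \<bar>p ! i - q ! i\<bar> \<noteq> 1 \<longrightarrow> p ! i = q ! i)"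

definition digital_image :: "int list set \<Rightarrow> (int list \<Rightarrow> int list \<Rightarrow> bool) \<Rightarrow> bool"
  where "digital_image X \<kappa> \<longleftrightarrow>
    finite X \<and> (\<exists>d l. 1 \<le> l \<and> l \<le> d \<and> X \<subseteq> int_lattice d \<and> \<kappa> = c_adj d l)"

definition digital_continuous ::
  "'a set \<Rightarrow> ('a \<Rightarrow> 'a \<Rightarrow> bool) \<Rightarrow> 'b set \<Rightarrow> ('b \<Rightarrow> 'b \<Rightarrow> bool) \<Rightarrow> ('a \<Rightarrow> 'b) \<Rightarrow> bool"
  where "digital_continuous X \<kappa> Y \<mu> f \<longleftrightarrow> f \<in> X \<rightarrow> Y \<and>
    (\<forall>x\<^sub>0\<in>X. \<forall>x\<^sub>1\<in>X. \<kappa> x\<^sub>0 x\<^sub>1 \<longrightarrow> f x\<^sub>0 = f x\<^sub>1 \<or> \<mu> (f x\<^sub>0) (f x\<^sub>1))"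

definition line_adj :: "int \<Rightarrow> int \<Rightarrow> bool"
  where "line_adj s t \<longleftrightarrow> c_adj 1 1 [s] [t]"

definition digital_homotopic ::
  "'a set \<Rightarrow> ('a \<Rightarrow> 'a \<Rightarrow> bool) \<Rightarrow> 'b set \<Rightarrow> ('b \<Rightarrow> 'b \<Rightarrow> bool) \<Rightarrow> ('a \<Rightarrow> 'b) \<Rightarrow> ('a \<Rightarrow> 'b) \<Rightarrow> bool"
  where "digital_homotopic X \<kappa> Y \<mu> f g \<longleftrightarrow>
    digital_continuous X \<kappa> Y \<mu> f \<and> digital_continuous X \<kappa> Y \<mu> g \<and>
    (\<exists>(m::int) H. m > 0 \<and> H \<in> {0..m} \<times> X \<rightarrow> Y \<and>
      (\<forall>x\<in>X. H (0, x) = f x) \<and> (\<forall>x\<in>X. H (m, x) = g x) \<and>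
      (\<forall>x\<in>X. digital_continuous {0..m} line_adj Y \<mu> (\<lambda>t. H (t, x))) \<and>
      (\<forall>t\<in>{0..m}. digital_continuous X \<kappa> Y \<mu> (\<lambda>x. H (t, x))))"

section \<open>Cubical singular chains\<close>

definition unit_cube :: "nat \<Rightarrow> int list set"
  where "unit_cube n = {t \<in> int_lattice n. set t \<subseteq> {0..1}}"

text \<open>Cubes are extensional functions on \<open>I\<^sup>n\<close>, so that equality of cubes is equality of terms.
  The degree is an integer; there are no cubes in negative degree, which makes \<open>dQ\<close> and \<open>dC\<close>
  trivial groups there.\<close>

definition digital_cubes ::
  "int \<Rightarrow> int list set \<Rightarrow> (int list \<Rightarrow> int list \<Rightarrow> bool) \<Rightarrow> (int list \<Rightarrow> int list) set"
  where "digital_cubes n X \<kappa> = {T. 0 \<le> n \<and> T \<in> extensional (unit_cube (nat n)) \<and>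
    digital_continuous (unit_cube (nat n)) (c_adj (nat n) 1) X \<kappa> T}"

text \<open>List positions start at \<open>0\<close>, so position \<open>i\<close> is the variable \<open>t\<^bsub>i+1\<^esub>\<close>.\<close>

definition degenerate_cubes ::
  "int \<Rightarrow> int list set \<Rightarrow> (int list \<Rightarrow> int list \<Rightarrow> bool) \<Rightarrow> (int list \<Rightarrow> int list) set"
  where "degenerate_cubes n X \<kappa> = {T \<in> digital_cubes n X \<kappa>.
    \<exists>i < nat n. \<forall>t\<in>unit_cube (nat n). \<forall>s\<in>{0..1}. T (t[i := s]) = T t}"

definition dQ ::
  "int \<Rightarrow> int list set \<Rightarrow> (int list \<Rightarrow> int list \<Rightarrow> bool) \<Rightarrow> ((int list \<Rightarrow> int list) \<Rightarrow>\<^sub>0 int) monoid"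
  where "dQ n X \<kappa> = free_Abelian_group (digital_cubes n X \<kappa>)"

definition dD ::
  "int \<Rightarrow> int list set \<Rightarrow> (int list \<Rightarrow> int list \<Rightarrow> bool) \<Rightarrow> ((int list \<Rightarrow> int list) \<Rightarrow>\<^sub>0 int) set"
  where "dD n X \<kappa> = generate (dQ n X \<kappa>) (frag_of ` degenerate_cubes n X \<kappa>)"

definition dC ::
  "int \<Rightarrow> int list set \<Rightarrow> (int list \<Rightarrow> int list \<Rightarrow> bool) \<Rightarrow> ((int list \<Rightarrow> int list) \<Rightarrow>\<^sub>0 int) set monoid"
  where "dC n X \<kappa> = dQ n X \<kappa> Mod dD n X \<kappa>"

text \<open>\<open>face n i e T\<close> inserts the value \<open>e\<close> as the \<open>i\<close>-th variable (\<open>1 \<le> i \<le> n\<close>) of the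
  \<open>n\<close>-cube \<open>T\<close>: it is \<open>A\<^sub>i T\<close> for \<open>e = 0\<close> and \<open>B\<^sub>i T\<close> for \<open>e = 1\<close>.\<close>

definition face :: "nat \<Rightarrow> nat \<Rightarrow> int \<Rightarrow> (int list \<Rightarrow> int list) \<Rightarrow> int list \<Rightarrow> int list"
  where "face n i e T = (\<lambda>t\<in>unit_cube (n - 1). T (take (i - 1) t @ e # drop (i - 1) t))"

text \<open>The sum is empty, hence the boundary is zero, for \<open>n \<le> 0\<close>.\<close>

definition boundary ::
  "int \<Rightarrow> ((int list \<Rightarrow> int list) \<Rightarrow>\<^sub>0 int) \<Rightarrow> ((int list \<Rightarrow> int list) \<Rightarrow>\<^sub>0 int)"
  where "boundary n = frag_extend (\<lambda>T. \<Sum>i = 1..nat n.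
    frag_cmul ((-1) ^ i) (frag_of (face (nat n) i 0 T) - frag_of (face (nat n) i 1 T)))"

definition push_forward ::
  "int \<Rightarrow> (int list \<Rightarrow> int list) \<Rightarrow> ((int list \<Rightarrow> int list) \<Rightarrow>\<^sub>0 int) \<Rightarrow> ((int list \<Rightarrow> int list) \<Rightarrow>\<^sub>0 int)"
  where "push_forward n f = frag_extend (\<lambda>T. frag_of (compose (unit_cube (nat n)) f T))"

section \<open>Homology\<close>

text \<open>The map \<open>G Mod N \<rightarrow> G' Mod N'\<close> sending the coset of \<open>x\<close> to the coset of \<open>h x\<close>, for a
  homomorphism \<open>h : G \<rightarrow> G'\<close> with \<open>h ` N \<subseteq> N'\<close>; its argument \<open>C\<close> is a coset of \<open>N\<close>.\<close>

definition quotient_map :: "('b, 'm) monoid_scheme \<Rightarrow> 'b set \<Rightarrow> ('a \<Rightarrow> 'b) \<Rightarrow> 'a set \<Rightarrow> 'b set"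
  where "quotient_map G' N' h C = the_elem ((\<lambda>x. N' #>\<^bsub>G'\<^esub> h x) ` C)"

definition dC_boundary ::
  "int \<Rightarrow> int list set \<Rightarrow> (int list \<Rightarrow> int list \<Rightarrow> bool) \<Rightarrow>
    ((int list \<Rightarrow> int list) \<Rightarrow>\<^sub>0 int) set \<Rightarrow> ((int list \<Rightarrow> int list) \<Rightarrow>\<^sub>0 int) set"
  where "dC_boundary n X \<kappa> = quotient_map (dQ (n - 1) X \<kappa>) (dD (n - 1) X \<kappa>) (boundary n)"

definition dC_map ::
  "int \<Rightarrow> int list set \<Rightarrow> (int list \<Rightarrow> int list \<Rightarrow> bool) \<Rightarrow> (int list \<Rightarrow> int list) \<Rightarrow>
    ((int list \<Rightarrow> int list) \<Rightarrow>\<^sub>0 int) set \<Rightarrow> ((int list \<Rightarrow> int list) \<Rightarrow>\<^sub>0 int) set"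
  where "dC_map n Y \<mu> f = quotient_map (dQ n Y \<mu>) (dD n Y \<mu>) (push_forward n f)"

definition dZ ::
  "int \<Rightarrow> int list set \<Rightarrow> (int list \<Rightarrow> int list \<Rightarrow> bool) \<Rightarrow> ((int list \<Rightarrow> int list) \<Rightarrow>\<^sub>0 int) set monoid"
  where "dZ n X \<kappa> = (dC n X \<kappa>)
    \<lparr>carrier := kernel (dC n X \<kappa>) (dC (n - 1) X \<kappa>) (dC_boundary n X \<kappa>)\<rparr>"

definition dB ::
  "int \<Rightarrow> int list set \<Rightarrow> (int list \<Rightarrow> int list \<Rightarrow> bool) \<Rightarrow> ((int list \<Rightarrow> int list) \<Rightarrow>\<^sub>0 int) set set"
  where "dB n X \<kappa> = dC_boundary (n + 1) X \<kappa> ` carrier (dC (n + 1) X \<kappa>)"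

definition dH ::
  "int \<Rightarrow> int list set \<Rightarrow> (int list \<Rightarrow> int list \<Rightarrow> bool) \<Rightarrow> ((int list \<Rightarrow> int list) \<Rightarrow>\<^sub>0 int) set set monoid"
  where "dH n X \<kappa> = dZ n X \<kappa> Mod dB n X \<kappa>"

text \<open>The induced map on homology is extensional on \<open>dH\<^sub>n(X)\<close>, so that equality of induced maps
  is equality on \<open>dH\<^sub>n(X)\<close>.\<close>

definition dH_map ::
  "int \<Rightarrow> int list set \<Rightarrow> (int list \<Rightarrow> int list \<Rightarrow> bool) \<Rightarrow>
    int list set \<Rightarrow> (int list \<Rightarrow> int list \<Rightarrow> bool) \<Rightarrow> (int list \<Rightarrow> int list) \<Rightarrow>
    ((int list \<Rightarrow> int list) \<Rightarrow>\<^sub>0 int) set set \<Rightarrow> ((int list \<Rightarrow> int list) \<Rightarrow>\<^sub>0 int) set set"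
  where "dH_map n X \<kappa> Y \<mu> f =
    restrict (quotient_map (dZ n Y \<mu>) (dB n Y \<mu>) (dC_map n Y \<mu> f)) (carrier (dH n X \<kappa>))"

end

theory Submission
  imports Defs
begin

text \<open>It suffices to treat one time step of the homotopy, that is, continuous maps \<open>f\<close> and \<open>g\<close> with
  \<open>f x\<close> and \<open>g x\<close> equal or adjacent for every \<open>x\<close>. A cube \<open>T\<close> then spans the prism that is
  \<open>f \<circ> T\<close> on the face \<open>t\<^sub>1 = 0\<close> and \<open>g \<circ> T\<close> on the face \<open>t\<^sub>1 = 1\<close>; it is continuous because a
  \<open>c\<^sub>1\<close>-adjacency changes only one coordinate. Prisms \<open>P\<close> satisfy
  \<open>g\<^sub># - f\<^sub># = \<partial>P + P\<partial>\<close> already on the free groups \<open>dQ\<close>, and \<open>P\<close> preserves degeneracy.\<close>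

section \<open>Maps between quotient groups\<close>

text \<open>Every element of the coset is \<open>a \<otimes> x\<close> with \<open>a\<close> in
  \<open>N\<close>, and \<open>h a\<close> is absorbed by \<open>N'\<close>. So the set of cosets
  under \<open>the_elem\<close> is a singleton.\<close>

lemma quotient_map_coset:
  assumes "group G" "group G'" "subgroup N G" "subgroup N' G'"
    and h: "h \<in> hom G G'" and sub: "h ` N \<subseteq> N'" and x: "x \<in> carrier G"
  shows "quotient_map G' N' h (N #>\<^bsub>G\<^esub> x) = N' #>\<^bsub>G'\<^esub> h x"
proof -
  interpret G: group G by fact
  interpret G': group G' by fact
  interpret N: subgroup N G by fact
  have "N' #>\<^bsub>G'\<^esub> h y = N' #>\<^bsub>G'\<^esub> h x" if y: "y \<in> N #>\<^bsub>G\<^esub> x" for y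
  proof -
    obtain a where a: "a \<in> N" "y = a \<otimes>\<^bsub>G\<^esub> x"
      using y by (auto simp: r_coset_def)
    then have "h y = h a \<otimes>\<^bsub>G'\<^esub> h x" "h a \<in> N'"
      using hom_mult [OF h N.mem_carrier x] sub by auto
    then have "h y \<in> N' #>\<^bsub>G'\<^esub> h x"
      by (auto simp: r_coset_def)
    then show ?thesis
      using G'.repr_independence [OF _ hom_in_carrier [OF h x] \<open>subgroup N' G'\<close>] by simp
  qed
  moreover have "x \<in> N #>\<^bsub>G\<^esub> x"
    using x by (rule G.rcos_self) fact
  ultimately have "(\<lambda>y. N' #>\<^bsub>G'\<^esub> h y) ` (N #>\<^bsub>G\<^esub> x) = {N' #>\<^bsub>G'\<^esub> h x}"
    by blast
  then show ?thesis
    by (simp add: quotient_map_def)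
qed

lemma quotient_map_hom:
  assumes "group G" "group G'" "N \<lhd> G" "N' \<lhd> G'" "h \<in> hom G G'" "h ` N \<subseteq> N'"
  shows "quotient_map G' N' h \<in> hom (G Mod N) (G' Mod N')"
proof -
  interpret N: normal N G by fact
  interpret N': normal N' G' by fact
  have q: "quotient_map G' N' h (N #>\<^bsub>G\<^esub> x) = N' #>\<^bsub>G'\<^esub> h x" if "x \<in> carrier G" for x
    using that assms N.subgroup_axioms N'.subgroup_axioms by (intro quotient_map_coset)
  show ?thesis
    using hom_in_carrier [OF \<open>h \<in> hom G G'\<close>] hom_mult [OF \<open>h \<in> hom G G'\<close>]
    by (auto simp: hom_def carrier_FactGroup q N.rcos_sum N'.rcos_sum)
qed

section \<open>Homomorphisms of free abelian groups\<close>

lemma frag_extend_hom: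
  assumes "\<And>x. x \<in> S \<Longrightarrow> Poly_Mapping.keys (h x) \<subseteq> S'"
  shows "frag_extend h \<in> hom (free_Abelian_group S) (free_Abelian_group S')"
proof (rule homI)
  fix c assume "c \<in> carrier (free_Abelian_group S)"
  then show "frag_extend h c \<in> carrier (free_Abelian_group S')"
    using keys_frag_extend [of h c] assms by auto
qed (simp add: frag_extend_add)

text \<open>A homomorphism carries a generated subgroup to the subgroup generated by the images.
  Preservation of degenerate chains can therefore be checked on degenerate cubes alone.\<close>

lemma frag_extend_generate:
  assumes keys: "\<And>x. x \<in> S \<Longrightarrow> Poly_Mapping.keys (h x) \<subseteq> S'" and "A \<subseteq> S"
    and N: "subgroup N (free_Abelian_group S')" and h: "\<And>x. x \<in> A \<Longrightarrow> h x \<in> N"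
  shows "frag_extend h ` generate (free_Abelian_group S) (frag_of ` A) \<subseteq> N"
proof -
  interpret group_hom "free_Abelian_group S" "free_Abelian_group S'" "frag_extend h"
    using frag_extend_hom [of S h S', OF keys] by (simp add: group_hom_def group_hom_axioms_def)
  have "frag_of ` A \<subseteq> carrier (free_Abelian_group S)"
    using \<open>A \<subseteq> S\<close> by (auto simp: keys_frag_of)
  then have "frag_extend h ` generate (free_Abelian_group S) (frag_of ` A)
      = generate (free_Abelian_group S') (frag_extend h ` frag_of ` A)"
    by (simp add: generate_img)
  also have "\<dots> \<subseteq> N"
    using h by (intro H.generate_subgroup_incl N) auto
  finally show ?thesis .
qed

lemma subgroup_free_Abelian_diff:
  assumes N: "subgroup N (free_Abelian_group S)" and "a \<in> N" "b \<in> N"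
  shows "a - b \<in> N"
proof -
  have "Poly_Mapping.keys b \<subseteq> S"
    using subgroup.mem_carrier [OF N \<open>b \<in> N\<close>] by simp
  \<comment> \<open>On the carrier of a free abelian group the group inverse is the additive
    negative.\<close>
  then have "- b \<in> N"
    using subgroup.m_inv_closed [OF N \<open>b \<in> N\<close>] by simp
  then show ?thesis
    using subgroup.m_closed [OF N \<open>a \<in> N\<close>, of "- b"] by simp
qed

lemma subgroup_free_Abelian_sum:
  assumes N: "subgroup N (free_Abelian_group S)" and "\<And>i. i \<in> I \<Longrightarrow> a i \<in> N"
  shows "sum a I \<in> N"
  using assms(2)
proof (induction I rule: infinite_finite_induct)
  case (insert i I)
  then show ?case
    using subgroup.m_closed [OF N, of "a i" "sum a I"] by simp
qed (use subgroup.one_closed [OF N] in auto)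

lemma subgroup_free_Abelian_sign:
  assumes N: "subgroup N (free_Abelian_group S)" and "a \<in> N"
  shows "frag_cmul ((-1) ^ i) a \<in> N"
  using subgroup_free_Abelian_diff [OF N subgroup.one_closed [OF N] \<open>a \<in> N\<close>] \<open>a \<in> N\<close>
  by (cases "even i") auto

section \<open>Cubes\<close>

lemma unit_cube_iff: "t \<in> unit_cube n \<longleftrightarrow> length t = n \<and> set t \<subseteq> {0, 1}"
  by (auto simp: unit_cube_def int_lattice_def)

lemma unit_cube_update: "t \<in> unit_cube n \<Longrightarrow> v \<in> {0, 1} \<Longrightarrow> t[i := v] \<in> unit_cube n"
  using set_update_subset_insert [of t i v] by (auto simp: unit_cube_iff)

lemma unit_cube_nth: "t \<in> unit_cube n \<Longrightarrow> i < n \<Longrightarrow> t ! i \<in> {0, 1}"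
  by (metis nth_mem subsetD unit_cube_iff)

lemma c_adj_sym: "c_adj d l p q \<Longrightarrow> c_adj d l q p"
  by (auto simp: c_adj_def abs_minus_commute)

lemma c_adj_update:
  assumes "length p = d" "i < d" "\<bar>p ! i - v\<bar> = 1"
  shows "c_adj d 1 p (p[i := v])"
proof -
  have other: "p[i := v] ! j = p ! j" if "j \<noteq> i" for j
    using that by simp
  have same: "p[i := v] ! i = v"
    using assms by simp
  have "{j. j < d \<and> \<bar>p ! j - p[i := v] ! j\<bar> = 1} = {i}"
    using assms other same by fastforce
  moreover have "p \<noteq> p[i := v]"
    using assms same by force
  moreover have "\<forall>j<d. \<bar>p ! j - p[i := v] ! j\<bar> \<noteq> 1 \<longrightarrow> p ! j = p[i := v] ! j"
    using assms other same by metis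
  ultimately show ?thesis
    using assms by (simp add: c_adj_def int_lattice_def)
qed

text \<open>The set \<open>D\<close> of positions that differ by one unit has at most one element,
  and \<open>p \<noteq> q\<close> forces it to have one; elsewhere the lists agree.\<close>

lemma c_adj_1_cases:
  assumes "c_adj d 1 p q"
  obtains i where "i < d" "q = p[i := q ! i]"
proof -
  define D where "D = {i. i < d \<and> \<bar>p ! i - q ! i\<bar> = 1}"
  have len: "length p = d" "length q = d" and "p \<noteq> q" and card: "card D \<le> Suc 0"
    using assms unfolding c_adj_def int_lattice_def D_def by simp_all
  have eq: "p ! i = q ! i" if "i < d" "i \<notin> D" for i
    using assms that unfolding c_adj_def D_def by blast
  have "finite D"
    by (simp add: D_def)
  obtain i where i: "i < d" "p ! i \<noteq> q ! i"
    using len \<open>p \<noteq> q\<close> nth_equalityI [of p q] by auto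
  then have "i \<in> D"
    using eq by blast
  have "q ! j = p[i := q ! i] ! j" if "j < d" for j
  proof (cases "j = i")
    case True
    then show ?thesis
      using i len by simp
  next
    case False
    then have "j \<notin> D"
      using card \<open>i \<in> D\<close> card_le_Suc0_iff_eq [OF \<open>finite D\<close>] by blast
    then show ?thesis
      using eq that False by simp
  qed
  then have "q = p[i := q ! i]"
    using len by (simp add: nth_equalityI)
  with \<open>i < d\<close> show thesis
    by (rule that)
qed

text \<open>Neighbours in the cube arise by changing one coordinate, so continuity can be tested one
  coordinate at a time. Writing back the old value is harmless because equality is permitted. This
  form passes directly to faces and prisms.\<close>

lemma digital_cubes_iff:
  "T \<in> digital_cubes (int n) X \<kappa> \<longleftrightarrow> T \<in> extensional (unit_cube n) \<and>
    (\<forall>t\<in>unit_cube n. T t \<in> X) \<and>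
    (\<forall>t\<in>unit_cube n. \<forall>i<n. \<forall>v\<in>{0, 1}. T t = T (t[i := v]) \<or> \<kappa> (T t) (T (t[i := v])))"
proof -
  have "(\<forall>t\<in>unit_cube n. \<forall>s\<in>unit_cube n. c_adj n 1 t s \<longrightarrow> T t = T s \<or> \<kappa> (T t) (T s)) \<longleftrightarrow>
    (\<forall>t\<in>unit_cube n. \<forall>i<n. \<forall>v\<in>{0, 1}. T t = T (t[i := v]) \<or> \<kappa> (T t) (T (t[i := v])))"
    (is "?L \<longleftrightarrow> ?R")
  proof
    assume L: ?L
    show ?R
    proof (intro ballI allI impI)
      fix t i and v :: int
      assume t: "t \<in> unit_cube n" and i: "i < n" and v: "v \<in> {0, 1}"
      have "t ! i \<in> {0, 1}"
        using t i by (rule unit_cube_nth)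
      then consider "v = t ! i" | "\<bar>t ! i - v\<bar> = 1"
        using v by auto
      then show "T t = T (t[i := v]) \<or> \<kappa> (T t) (T (t[i := v]))"
      proof cases
        case 2
        then show ?thesis
          using L t i unit_cube_update [OF t v] c_adj_update [of t n i v]
          by (auto simp: unit_cube_iff)
      qed simp
    qed
  next
    assume R: ?R
    show ?L
    proof (intro ballI impI)
      fix t s assume ts: "t \<in> unit_cube n" "s \<in> unit_cube n" "c_adj n 1 t s"
      then obtain i where i: "i < n" "s = t[i := s ! i]"
        using c_adj_1_cases by blast
      have "s ! i \<in> {0, 1}"
        using ts(2) i(1) by (rule unit_cube_nth)
      then show "T t = T s \<or> \<kappa> (T t) (T s)"
        using R ts i by metis
    qed
  qed
  then show ?thesis
    by (simp add: digital_cubes_def digital_continuous_def Pi_iff)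
qed

lemma degenerate_cubes_iff:
  "T \<in> degenerate_cubes (int n) X \<kappa> \<longleftrightarrow> T \<in> digital_cubes (int n) X \<kappa> \<and>
    (\<exists>i<n. \<forall>t\<in>unit_cube n. \<forall>v\<in>{0, 1}. T (t[i := v]) = T t)"
proof -
  have "{0..1::int} = {0, 1}"
    by auto
  then show ?thesis
    by (simp add: degenerate_cubes_def)
qed

lemma degenerate_cubes_subset: "degenerate_cubes n X \<kappa> \<subseteq> digital_cubes n X \<kappa>"
  by (auto simp: degenerate_cubes_def)

lemma digital_cubes_nonneg: "T \<in> digital_cubes n X \<kappa> \<Longrightarrow> 0 \<le> n"
  by (simp add: digital_cubes_def)

section \<open>Faces of cubes\<close>

text \<open>\<open>face\<close> inserts at \<open>i - 1\<close>; naming the insertion by its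
  position counted from 0 removes the subtraction from all later index calculations.\<close>

definition insert_nth :: "nat \<Rightarrow> 'a \<Rightarrow> 'a list \<Rightarrow> 'a list"
  where "insert_nth i e t = take i t @ e # drop i t"

lemma insert_nth_0 [simp]: "insert_nth 0 e t = e # t"
  by (simp add: insert_nth_def)

lemma insert_nth_Suc_Cons [simp]: "insert_nth (Suc i) e (x # t) = x # insert_nth i e t"
  by (simp add: insert_nth_def)

text \<open>Translates a step inside a face into a step of the whole cube. An index \<open>j\<close>
  beyond the list does no harm, as both updates then change nothing.\<close>

lemma insert_nth_list_update:
  assumes "i \<le> length t"
  shows "insert_nth i e (t[j := v]) = (insert_nth i e t)[if j < i then j else Suc j := v]"
  using assms
  by (auto simp: insert_nth_def list_update_append take_update_swap drop_update_swap
      Suc_diff_le list_update_beyond)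

lemma insert_nth_update_same:
  assumes "i \<le> length t"
  shows "(insert_nth i e t)[i := v] = insert_nth i v t"
  using assms by (simp add: insert_nth_def list_update_append)

lemma insert_nth_unit_cube:
  assumes "t \<in> unit_cube n" "i \<le> n" "e \<in> {0, 1}"
  shows "insert_nth i e t \<in> unit_cube (Suc n)"
  using assms set_take_subset [of i t] set_drop_subset [of i t]
  by (auto simp: unit_cube_iff insert_nth_def)

lemma face_Suc: "face (Suc n) (Suc i) e T = (\<lambda>t\<in>unit_cube n. T (insert_nth i e t))"
  by (simp add: face_def insert_nth_def)

text \<open>A step in coordinate \<open>j\<close> of the face is a step of \<open>T\<close> in
  coordinate \<open>j\<close> or \<open>Suc j\<close>, so continuity is inherited.\<close>

lemma face_digital_cubes:
  assumes T: "T \<in> digital_cubes (int (Suc n)) X \<kappa>" and "i \<le> n" "e \<in> {0, 1}"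
  shows "face (Suc n) (Suc i) e T \<in> digital_cubes (int n) X \<kappa>"
proof -
  have "T (insert_nth i e t) = T (insert_nth i e (t[j := v])) \<or>
      \<kappa> (T (insert_nth i e t)) (T (insert_nth i e (t[j := v])))"
    if "t \<in> unit_cube n" "j < n" "v \<in> {0, 1}" for t j v
  proof -
    have "(if j < i then j else Suc j) < Suc n" "i \<le> length t"
      using that \<open>i \<le> n\<close> by (auto simp: unit_cube_iff)
    then show ?thesis
      using T that insert_nth_unit_cube [OF that(1) assms(2,3)] unfolding digital_cubes_iff
      by (subst (1 2) insert_nth_list_update) blast+
  qed
  then show ?thesis
    using T assms unfolding digital_cubes_iff face_Suc
    by (simp add: insert_nth_unit_cube unit_cube_update)
qed

lemma face_degenerate:
  assumes T: "T \<in> digital_cubes (int (Suc n)) X \<kappa>" and k: "k \<le> n"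
    and deg: "\<And>t v. t \<in> unit_cube (Suc n) \<Longrightarrow> v \<in> {0, 1} \<Longrightarrow> T (t[k := v]) = T t"
    and "i \<le> n" "e \<in> {0, 1}" "i \<noteq> k"
  shows "face (Suc n) (Suc i) e T \<in> degenerate_cubes (int n) X \<kappa>"
proof -
  \<comment> \<open>The variable that \<open>T\<close> ignores survives in the face;
    \<open>j\<close> is its position once coordinate \<open>i\<close> has been removed.\<close>
  define j where "j = (if k < i then k else k - 1)"
  have j: "j < n" "(if j < i then j else Suc j) = k"
    using k \<open>i \<le> n\<close> \<open>i \<noteq> k\<close> by (auto simp: j_def)
  have "T (insert_nth i e (t[j := v])) = T (insert_nth i e t)"
    if "t \<in> unit_cube n" "v \<in> {0, 1}" for t v
  proof -
    have "insert_nth i e (t[j := v]) = (insert_nth i e t)[k := v]"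
      using that \<open>i \<le> n\<close> by (subst insert_nth_list_update) (auto simp: j unit_cube_iff)
    then show ?thesis
      using deg insert_nth_unit_cube [OF that(1) assms(4,5)] that by simp
  qed
  then show ?thesis
    using face_digital_cubes [OF T assms(4,5)] j(1)
    unfolding degenerate_cubes_iff face_Suc by (auto simp: unit_cube_update)
qed

lemma faces_eq_degenerate:
  assumes "k \<le> n"
    and deg: "\<And>t v. t \<in> unit_cube (Suc n) \<Longrightarrow> v \<in> {0, 1} \<Longrightarrow> T (t[k := v]) = T t"
  shows "face (Suc n) (Suc k) 0 T = face (Suc n) (Suc k) 1 T"
proof -
  have "T (insert_nth k 0 t) = T (insert_nth k 1 t)" if "t \<in> unit_cube n" for t
    using deg [of "insert_nth k 1 t" 0] that assms(1) insert_nth_unit_cube [OF that assms(1), of 1]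
      insert_nth_update_same [of k t 1 0]
    by (auto simp: unit_cube_iff)
  then show ?thesis
    by (auto simp: face_Suc restrict_def)
qed

section \<open>Chain maps\<close>

lemma group_dQ [simp]: "group (dQ n X \<kappa>)"
  by (simp add: dQ_def)

lemma subgroup_dD: "subgroup (dD n X \<kappa>) (dQ n X \<kappa>)"
  unfolding dD_def
  by (rule group.generate_is_subgroup)
    (auto simp: dQ_def keys_frag_of subsetD [OF degenerate_cubes_subset])

lemma normal_dD: "dD n X \<kappa> \<lhd> dQ n X \<kappa>"
  using comm_group.subgroup_imp_normal subgroup_dD abelian_free_Abelian_group
  unfolding dQ_def by metis

lemma comm_group_dC: "comm_group (dC n X \<kappa>)"
  using comm_group.abelian_FactGroup subgroup_dD abelian_free_Abelian_group
  unfolding dC_def dQ_def by metis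

lemma frag_of_degenerate: "T \<in> degenerate_cubes n X \<kappa> \<Longrightarrow> frag_of T \<in> dD n X \<kappa>"
  by (simp add: dD_def generate.incl)

lemma frag_extend_dQ_hom:
  assumes "\<And>T. T \<in> digital_cubes n X \<kappa> \<Longrightarrow> h T \<in> carrier (dQ m Y \<mu>)"
  shows "frag_extend h \<in> hom (dQ n X \<kappa>) (dQ m Y \<mu>)"
  using assms frag_extend_hom unfolding dQ_def by (metis carrier_free_Abelian_group_iff)

lemma frag_extend_dD:
  assumes "\<And>T. T \<in> digital_cubes n X \<kappa> \<Longrightarrow> h T \<in> carrier (dQ m Y \<mu>)"
    and "\<And>T. T \<in> degenerate_cubes n X \<kappa> \<Longrightarrow> h T \<in> dD m Y \<mu>"
  shows "frag_extend h ` dD n X \<kappa> \<subseteq> dD m Y \<mu>"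
  unfolding dD_def [of n] dQ_def
proof (rule frag_extend_generate)
  show "subgroup (dD m Y \<mu>) (free_Abelian_group (digital_cubes m Y \<mu>))"
    using subgroup_dD by (simp add: dQ_def)
qed (use assms degenerate_cubes_subset in \<open>auto simp: dQ_def\<close>)

section \<open>The boundary on chains\<close>

lemma boundary_frag_of:
  "boundary n (frag_of T) = (\<Sum>i = 1..nat n.
    frag_cmul ((-1) ^ i) (frag_of (face (nat n) i 0 T) - frag_of (face (nat n) i 1 T)))"
  by (simp add: boundary_def)

text \<open>Counting the directions from 0 instead of 1 flips every sign, which produces the minus
  in front.\<close>

lemma boundary_frag_of_Suc:
  "boundary (int (Suc n)) (frag_of T) = - (\<Sum>i\<le>n.
    frag_cmul ((-1) ^ i) (frag_of (face (Suc n) (Suc i) 0 T) - frag_of (face (Suc n) (Suc i) 1 T)))"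
proof -
  have "boundary (int (Suc n)) (frag_of T) = (\<Sum>i = Suc 0..Suc n.
    frag_cmul ((-1) ^ i) (frag_of (face (Suc n) i 0 T) - frag_of (face (Suc n) i 1 T)))"
    by (simp only: boundary_frag_of nat_int One_nat_def)
  then show ?thesis
    by (simp add: sum.shift_bounds_cl_Suc_ivl atMost_atLeast0 flip: sum_negf del: sum.cl_ivl_Suc)
qed

text \<open>Serves twice: with \<open>N\<close> all of \<open>dQ\<close> the boundary of a cube is a
  chain, and with \<open>N\<close> equal to \<open>dD\<close> the boundary of a degenerate cube is
  degenerate.\<close>

lemma boundary_mem_subgroup:
  assumes N: "subgroup N (free_Abelian_group S)"
    and "\<And>i. i \<le> n \<Longrightarrow> frag_of (face (Suc n) (Suc i) 0 T) - frag_of (face (Suc n) (Suc i) 1 T) \<in> N"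
  shows "boundary (int (Suc n)) (frag_of T) \<in> N"
proof -
  have "0 \<in> N"
    using subgroup.one_closed [OF N] by simp
  moreover have "(\<Sum>i\<le>n. frag_cmul ((-1) ^ i)
      (frag_of (face (Suc n) (Suc i) 0 T) - frag_of (face (Suc n) (Suc i) 1 T))) \<in> N"
    by (intro subgroup_free_Abelian_sum [OF N] subgroup_free_Abelian_sign [OF N] assms) simp
  ultimately show ?thesis
    unfolding boundary_frag_of_Suc using subgroup_free_Abelian_diff [OF N, of 0] by simp
qed

lemma boundary_dQ:
  assumes T: "T \<in> digital_cubes n X \<kappa>"
  shows "boundary n (frag_of T) \<in> carrier (dQ (n - 1) X \<kappa>)"
proof (cases "n \<le> 0")
  case False
  then obtain k where n: "n = int (Suc k)"
    by (metis gr0_conv_Suc not_le zero_less_imp_eq_int)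
  have N: "subgroup (carrier (dQ (int k) X \<kappa>)) (free_Abelian_group (digital_cubes (int k) X \<kappa>))"
    by (simp add: dQ_def group.subgroup_self)
  have "frag_of (face (Suc k) (Suc i) e T) \<in> carrier (dQ (int k) X \<kappa>)"
    if "i \<le> k" "e \<in> {0, 1}" for i e
    using face_digital_cubes [of T k] T that n by (auto simp: dQ_def keys_frag_of)
  then have "boundary (int (Suc k)) (frag_of T) \<in> carrier (dQ (int k) X \<kappa>)"
    by (intro boundary_mem_subgroup [OF N] subgroup_free_Abelian_diff [OF N]) simp_all
  then show ?thesis
    by (simp add: n)
qed (simp add: boundary_frag_of dQ_def)

text \<open>In the direction \<open>k\<close> that \<open>T\<close> ignores, the two faces coincide
  and cancel. In any other direction both faces still ignore that variable and are
  degenerate.\<close>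

lemma boundary_dD:
  assumes T: "T \<in> degenerate_cubes n X \<kappa>"
  shows "boundary n (frag_of T) \<in> dD (n - 1) X \<kappa>"
proof (cases "n \<le> 0")
  case True
  then show ?thesis
    using subgroup.one_closed [OF subgroup_dD, of "n - 1" X \<kappa>]
    by (simp add: boundary_frag_of dQ_def)
next
  case False
  then obtain m where n: "n = int (Suc m)"
    by (metis gr0_conv_Suc not_le zero_less_imp_eq_int)
  obtain k where cube: "T \<in> digital_cubes (int (Suc m)) X \<kappa>" and "k \<le> m"
    and deg: "\<And>t v. t \<in> unit_cube (Suc m) \<Longrightarrow> v \<in> {0, 1} \<Longrightarrow> T (t[k := v]) = T t"
    using T unfolding n degenerate_cubes_iff by (metis less_Suc_eq_le)
  have N: "subgroup (dD (int m) X \<kappa>) (free_Abelian_group (digital_cubes (int m) X \<kappa>))"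
    using subgroup_dD by (simp add: dQ_def)
  have "frag_of (face (Suc m) (Suc i) 0 T) - frag_of (face (Suc m) (Suc i) 1 T) \<in> dD (int m) X \<kappa>"
    if "i \<le> m" for i
  proof (cases "i = k")
    case True
    then have "face (Suc m) (Suc i) 0 T = face (Suc m) (Suc i) 1 T"
      using faces_eq_degenerate [OF \<open>k \<le> m\<close> deg] by blast
    then show ?thesis
      using subgroup.one_closed [OF N] by simp
  next
    case False
    then have "frag_of (face (Suc m) (Suc i) e T) \<in> dD (int m) X \<kappa>" if "e \<in> {0, 1}" for e
      using face_degenerate [OF cube \<open>k \<le> m\<close> deg \<open>i \<le> m\<close> that False] frag_of_degenerate by blast
    then show ?thesis
      by (intro subgroup_free_Abelian_diff [OF N]) simp_all
  qed
  then have "boundary (int (Suc m)) (frag_of T) \<in> dD (int m) X \<kappa>"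
    by (rule boundary_mem_subgroup [OF N])
  then show ?thesis
    by (simp add: n)
qed

text \<open>Presents the boundary as the linear extension of its values on cubes, so that the
  general facts on \<open>frag_extend\<close> apply.\<close>

lemma boundary_eq_frag_extend: "boundary n = frag_extend (\<lambda>T. boundary n (frag_of T))"
  by (simp add: boundary_def)

lemma boundary_hom: "boundary n \<in> hom (dQ n X \<kappa>) (dQ (n - 1) X \<kappa>)"
  by (subst boundary_eq_frag_extend) (intro frag_extend_dQ_hom boundary_dQ)

lemma boundary_image_dD: "boundary n ` dD n X \<kappa> \<subseteq> dD (n - 1) X \<kappa>"
  by (subst boundary_eq_frag_extend) (intro frag_extend_dD boundary_dQ boundary_dD)

lemma dC_boundary_coset:
  "c \<in> carrier (dQ n X \<kappa>) \<Longrightarrow>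
    dC_boundary n X \<kappa> (dD n X \<kappa> #>\<^bsub>dQ n X \<kappa>\<^esub> c) = dD (n - 1) X \<kappa> #>\<^bsub>dQ (n - 1) X \<kappa>\<^esub> boundary n c"
  unfolding dC_boundary_def
  by (intro quotient_map_coset group_dQ subgroup_dD boundary_hom boundary_image_dD)

lemma dC_boundary_hom: "dC_boundary n X \<kappa> \<in> hom (dC n X \<kappa>) (dC (n - 1) X \<kappa>)"
  unfolding dC_boundary_def dC_def
  by (intro quotient_map_hom group_dQ normal_dD boundary_hom boundary_image_dD)

lemma subgroup_dB: "subgroup (dB n X \<kappa>) (dC n X \<kappa>)"
proof -
  interpret group_hom "dC (n + 1) X \<kappa>" "dC n X \<kappa>" "dC_boundary (n + 1) X \<kappa>"
    using dC_boundary_hom [of "n + 1"] comm_group_dC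
    by (auto simp: group_hom_def group_hom_axioms_def comm_group_def)
  show ?thesis
    unfolding dB_def by (rule img_is_subgroup)
qed

section \<open>Chain maps induced by continuous maps\<close>

lemma digital_continuous_mem: "digital_continuous X \<kappa> Y \<mu> f \<Longrightarrow> x \<in> X \<Longrightarrow> f x \<in> Y"
  by (auto simp: digital_continuous_def)

lemma digital_continuous_compose:
  assumes T: "digital_continuous I \<iota> X \<kappa> T" and f: "digital_continuous X \<kappa> Y \<mu> f"
  shows "digital_continuous I \<iota> Y \<mu> (compose I f T)"
proof -
  have mem: "T s \<in> X" "f (T s) \<in> Y" if "s \<in> I" for s
    using that T f digital_continuous_mem by metis+
  have "f (T s) = f (T t) \<or> \<mu> (f (T s)) (f (T t))" if "s \<in> I" "t \<in> I" "\<iota> s t" for s t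
    using T f mem(1) that unfolding digital_continuous_def by metis
  with mem show ?thesis
    by (simp add: digital_continuous_def compose_def Pi_iff)
qed

lemma compose_digital_cubes:
  assumes f: "digital_continuous X \<kappa> Y \<mu> f" and T: "T \<in> digital_cubes n X \<kappa>"
  shows "compose (unit_cube (nat n)) f T \<in> digital_cubes n Y \<mu>"
  using T by (auto simp: digital_cubes_def intro: digital_continuous_compose [OF _ f])

lemma compose_degenerate_cubes:
  assumes f: "digital_continuous X \<kappa> Y \<mu> f" and T: "T \<in> degenerate_cubes n X \<kappa>"
  shows "compose (unit_cube (nat n)) f T \<in> degenerate_cubes n Y \<mu>"
proof -
  obtain m where n: "n = int m"
    using T digital_cubes_nonneg degenerate_cubes_subset by (metis nonneg_int_cases subsetD)
  then have "compose (unit_cube (nat n)) f T \<in> digital_cubes n Y \<mu>"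
    using compose_digital_cubes [OF f] T degenerate_cubes_subset by blast
  then show ?thesis
    using T unfolding n degenerate_cubes_iff by (auto simp: compose_def unit_cube_update)
qed

lemma push_forward_hom:
  assumes "digital_continuous X \<kappa> Y \<mu> f"
  shows "push_forward n f \<in> hom (dQ n X \<kappa>) (dQ n Y \<mu>)"
  unfolding push_forward_def
  by (intro frag_extend_dQ_hom) (simp add: dQ_def keys_frag_of compose_digital_cubes [OF assms])

lemma push_forward_image_dD:
  assumes "digital_continuous X \<kappa> Y \<mu> f"
  shows "push_forward n f ` dD n X \<kappa> \<subseteq> dD n Y \<mu>"
  unfolding push_forward_def
  by (intro frag_extend_dD)
    (simp_all add: dQ_def keys_frag_of compose_digital_cubes [OF assms]
      frag_of_degenerate compose_degenerate_cubes [OF assms])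

lemma dC_map_coset:
  assumes "digital_continuous X \<kappa> Y \<mu> f" "c \<in> carrier (dQ n X \<kappa>)"
  shows "dC_map n Y \<mu> f (dD n X \<kappa> #>\<^bsub>dQ n X \<kappa>\<^esub> c) = dD n Y \<mu> #>\<^bsub>dQ n Y \<mu>\<^esub> push_forward n f c"
  unfolding dC_map_def
  by (intro quotient_map_coset group_dQ subgroup_dD push_forward_hom push_forward_image_dD assms)

lemma dC_map_hom:
  assumes "digital_continuous X \<kappa> Y \<mu> f"
  shows "dC_map n Y \<mu> f \<in> hom (dC n X \<kappa>) (dC n Y \<mu>)"
  unfolding dC_map_def dC_def
  by (intro quotient_map_hom group_dQ normal_dD push_forward_hom push_forward_image_dD assms)

text \<open>Composition acts on values and faces act on arguments, so they commute once the inserted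
  point is known to stay in the cube, where \<open>compose\<close> is defined.\<close>

lemma face_compose:
  assumes "i \<le> n" "e \<in> {0, 1}"
  shows "face (Suc n) (Suc i) e (compose (unit_cube (Suc n)) f T)
    = compose (unit_cube n) f (face (Suc n) (Suc i) e T)"
  using insert_nth_unit_cube [OF _ assms] by (auto simp: face_Suc compose_def restrict_def)

text \<open>Both sides are additive in \<open>c\<close>, so a single cube suffices, and there it is
  \<open>face_compose\<close> term by term.\<close>

lemma push_forward_boundary:
  assumes "c \<in> carrier (dQ n X \<kappa>)"
  shows "push_forward (n - 1) f (boundary n c) = boundary n (push_forward n f c)"
proof -
  have "Poly_Mapping.keys c \<subseteq> digital_cubes n X \<kappa>"
    using assms by (simp add: dQ_def)
  then show ?thesis
  proof (induction c rule: frag_induction)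
    case (one T)
    show ?case
    proof (cases "n \<le> 0")
      case True
      then show ?thesis
        by (simp add: boundary_frag_of push_forward_def)
    next
      case False
      then obtain m where n: "n = int (Suc m)"
        by (metis gr0_conv_Suc not_le zero_less_imp_eq_int)
      have "push_forward (int m) f (boundary (int (Suc m)) (frag_of T))
          = boundary (int (Suc m)) (frag_of (compose (unit_cube (Suc m)) f T))"
        unfolding boundary_frag_of_Suc push_forward_def
        by (simp add: frag_extend_minus frag_extend_sum frag_extend_cmul frag_extend_diff
            face_compose o_def del: of_nat_Suc)
      then show ?thesis
        by (simp add: n push_forward_def nat_int del: of_nat_Suc) (simp add: nat_add_distrib)
    qed
  qed (simp_all add: boundary_def push_forward_def frag_extend_diff)
qed

text \<open>If \<open>b\<close> is the class of the boundary of \<open>c\<close>, its image is the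
  class of the boundary of the push-forward of \<open>c\<close>.\<close>

lemma dC_map_dB:
  assumes f: "digital_continuous X \<kappa> Y \<mu> f" and b: "b \<in> dB n X \<kappa>"
  shows "dC_map n Y \<mu> f b \<in> dB n Y \<mu>"
proof -
  obtain c where c: "c \<in> carrier (dQ (n + 1) X \<kappa>)"
    and "b = dC_boundary (n + 1) X \<kappa> (dD (n + 1) X \<kappa> #>\<^bsub>dQ (n + 1) X \<kappa>\<^esub> c)"
    using b by (auto simp: dB_def dC_def carrier_FactGroup)
  then have "b = dD n X \<kappa> #>\<^bsub>dQ n X \<kappa>\<^esub> boundary (n + 1) c"
    by (simp add: dC_boundary_coset)
  moreover have "boundary (n + 1) c \<in> carrier (dQ n X \<kappa>)"
    using hom_in_carrier [OF boundary_hom c] by simp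
  ultimately have "dC_map n Y \<mu> f b = dD n Y \<mu> #>\<^bsub>dQ n Y \<mu>\<^esub> boundary (n + 1) (push_forward (n + 1) f c)"
    using push_forward_boundary [OF c, of f] by (simp add: dC_map_coset [OF f])
  moreover have fc: "push_forward (n + 1) f c \<in> carrier (dQ (n + 1) Y \<mu>)"
    using hom_in_carrier [OF push_forward_hom [OF f] c] .
  ultimately have "dC_map n Y \<mu> f b = dC_boundary (n + 1) Y \<mu>
      (dD (n + 1) Y \<mu> #>\<^bsub>dQ (n + 1) Y \<mu>\<^esub> push_forward (n + 1) f c)"
    by (simp add: dC_boundary_coset)
  then show ?thesis
    using fc by (auto simp: dB_def dC_def carrier_FactGroup)
qed

section \<open>The prism operator\<close>

text \<open>The time variable is placed in front, so the variables of \<open>T\<close> keep their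
  order and their positions rise by one.\<close>

definition prism :: "nat \<Rightarrow> ('a \<Rightarrow> 'b) \<Rightarrow> ('a \<Rightarrow> 'b) \<Rightarrow> (int list \<Rightarrow> 'a) \<Rightarrow> int list \<Rightarrow> 'b"
  where "prism n f g T = (\<lambda>u\<in>unit_cube (Suc n). if hd u = 0 then f (T (tl u)) else g (T (tl u)))"

lemma Cons_unit_cube_iff: "x # t \<in> unit_cube (Suc n) \<longleftrightarrow> x \<in> {0, 1} \<and> t \<in> unit_cube n"
  by (auto simp: unit_cube_iff)

lemma unit_cube_SucE:
  assumes "u \<in> unit_cube (Suc n)"
  obtains x t where "u = x # t" "x \<in> {0, 1}" "t \<in> unit_cube n"
  using assms by (cases u) (auto simp: unit_cube_iff)

lemma prism_Cons:
  "x \<in> {0, 1} \<Longrightarrow> t \<in> unit_cube n \<Longrightarrow> prism n f g T (x # t) = (if x = 0 then f (T t) else g (T t))"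
  by (simp add: prism_def Cons_unit_cube_iff)

lemma face_0_prism: "face (Suc n) (Suc 0) 0 (prism n f g T) = compose (unit_cube n) f T"
  by (rule ext) (simp add: face_Suc compose_def restrict_def prism_Cons)

lemma face_1_prism: "face (Suc n) (Suc 0) 1 (prism n f g T) = compose (unit_cube n) g T"
  by (rule ext) (simp add: face_Suc compose_def restrict_def prism_Cons)

lemma face_Suc_prism:
  assumes "i \<le> n" "e \<in> {0, 1}"
  shows "face (Suc (Suc n)) (Suc (Suc i)) e (prism (Suc n) f g T)
    = prism n f g (face (Suc n) (Suc i) e T)"
proof
  fix u
  show "face (Suc (Suc n)) (Suc (Suc i)) e (prism (Suc n) f g T) u
    = prism n f g (face (Suc n) (Suc i) e T) u"
  proof (cases "u \<in> unit_cube (Suc n)")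
    case True
    then obtain x t where u: "u = x # t" "x \<in> {0, 1}" "t \<in> unit_cube n"
      by (rule unit_cube_SucE)
    then have "insert_nth i e t \<in> unit_cube (Suc n)"
      using assms insert_nth_unit_cube by blast
    then show ?thesis
      using True u by (simp add: face_Suc prism_Cons)
  next
    case False
    then show ?thesis
      by (simp add: face_Suc prism_def)
  qed
qed

definition prism_chain ::
  "int \<Rightarrow> (int list \<Rightarrow> int list) \<Rightarrow> (int list \<Rightarrow> int list) \<Rightarrow>
    ((int list \<Rightarrow> int list) \<Rightarrow>\<^sub>0 int) \<Rightarrow> ((int list \<Rightarrow> int list) \<Rightarrow>\<^sub>0 int)"
  where "prism_chain n f g = frag_extend (\<lambda>T. frag_of (prism (nat n) f g T))"

text \<open>This is the chain homotopy formula. The time direction of the prism contributes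
  \<open>g \<circ> T\<close> minus \<open>f \<circ> T\<close>. The other faces are prisms over the
  faces of \<open>T\<close>; their directions are shifted by one, so they carry the opposite sign
  and cancel the prism of the boundary.\<close>

lemma prism_chain_homotopy:
  assumes "c \<in> carrier (dQ n X \<kappa>)"
  shows "push_forward n g c =
    push_forward n f c + (boundary (n + 1) (prism_chain n f g c) + prism_chain (n - 1) f g (boundary n c))"
proof -
  have "Poly_Mapping.keys c \<subseteq> digital_cubes n X \<kappa>"
    using assms by (simp add: dQ_def)
  then show ?thesis
  proof (induction c rule: frag_induction)
    case (one T)
    then obtain m where n: "n = int m"
      using digital_cubes_nonneg by (metis nonneg_int_cases)
    show ?case
    proof (cases m)
      \<comment> \<open>A point has zero boundary, and its prism is an edge whose only faces are the
        two ends.\<close>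
      case 0
      have "boundary (int (Suc 0)) (frag_of (prism 0 f g T)) =
          frag_of (compose (unit_cube 0) g T) - frag_of (compose (unit_cube 0) f T)"
        unfolding boundary_frag_of_Suc
        by (simp add: face_0_prism face_1_prism [unfolded One_nat_def])
      then show ?thesis
        by (simp add: n 0 push_forward_def prism_chain_def boundary_frag_of)
    next
      case (Suc k)
      let ?P = "\<lambda>i e. frag_of (prism k f g (face (Suc k) (Suc i) e T))"
      have "boundary (int (Suc (Suc k))) (frag_of (prism (Suc k) f g T)) =
          frag_of (compose (unit_cube (Suc k)) g T) - frag_of (compose (unit_cube (Suc k)) f T)
          + (\<Sum>i\<le>k. frag_cmul ((-1) ^ i) (?P i 0 - ?P i 1))"
        \<comment> \<open>The summand split off is the time direction; the index shift in the rest
          absorbs the leading minus sign.\<close>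
        unfolding boundary_frag_of_Suc sum.atMost_Suc_shift
        by (simp add: face_0_prism face_1_prism face_Suc_prism flip: sum_negf)
      moreover have "prism_chain (int k) f g (boundary (int (Suc k)) (frag_of T)) =
          - (\<Sum>i\<le>k. frag_cmul ((-1) ^ i) (?P i 0 - ?P i 1))"
        unfolding boundary_frag_of_Suc prism_chain_def
        by (simp add: frag_extend_minus frag_extend_sum frag_extend_cmul frag_extend_diff o_def)
      moreover have "n + 1 = int (Suc (Suc k))" "n - 1 = int k" "n = int (Suc k)"
        by (simp_all add: n Suc)
      ultimately show ?thesis
        by (simp only: push_forward_def prism_chain_def frag_extend_of nat_int) simp
    qed
  qed (simp_all add: boundary_def push_forward_def prism_chain_def frag_extend_diff algebra_simps)
qed

section \<open>One time step of a homotopy\<close>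

text \<open>\<open>close\<close> relates \<open>f x\<close> to \<open>g x\<close> in this order
  only; \<open>sym\<close> supplies the reverse order for time edges traversed from 1 to 0.\<close>

locale homotopy_step =
  fixes X :: "int list set" and \<kappa> :: "int list \<Rightarrow> int list \<Rightarrow> bool"
    and Y :: "int list set" and \<mu> :: "int list \<Rightarrow> int list \<Rightarrow> bool"
    and f g :: "int list \<Rightarrow> int list"
  assumes cont_f: "digital_continuous X \<kappa> Y \<mu> f"
    and cont_g: "digital_continuous X \<kappa> Y \<mu> g"
    and close: "x \<in> X \<Longrightarrow> f x = g x \<or> \<mu> (f x) (g x)"
    and sym: "\<mu> p q \<Longrightarrow> \<mu> q p"
begin

text \<open>A step changes either the time alone, which is \<open>close\<close>, or one variable of
  \<open>T\<close> at fixed time, which is continuity of \<open>T\<close> followed by that of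
  \<open>f\<close> or \<open>g\<close>.\<close>

lemma prism_digital_cubes:
  assumes T: "T \<in> digital_cubes (int n) X \<kappa>"
  shows "prism n f g T \<in> digital_cubes (int (Suc n)) Y \<mu>"
proof -
  have TX: "T t \<in> X" if "t \<in> unit_cube n" for t
    using T that unfolding digital_cubes_iff by blast
  have TY: "f (T t) \<in> Y" "g (T t) \<in> Y" if "t \<in> unit_cube n" for t
    using TX [OF that] cont_f cont_g digital_continuous_mem by metis+
  have step: "h (T t) = h (T (t[i := v])) \<or> \<mu> (h (T t)) (h (T (t[i := v])))"
    if h: "digital_continuous X \<kappa> Y \<mu> h" and t: "t \<in> unit_cube n" "i < n" "v \<in> {0, 1}" for h t i v
  proof -
    have "T t = T (t[i := v]) \<or> \<kappa> (T t) (T (t[i := v]))"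
      using T t unfolding digital_cubes_iff by blast
    then show ?thesis
      using h TX [OF t(1)] TX [OF unit_cube_update [OF t(1,3)]]
      unfolding digital_continuous_def by metis
  qed
  have "prism n f g T u = prism n f g T (u[i := v]) \<or> \<mu> (prism n f g T u) (prism n f g T (u[i := v]))"
    if "u \<in> unit_cube (Suc n)" and i: "i < Suc n" and v: "v \<in> {0, 1}" for u i v
  proof -
    obtain x t where u: "u = x # t" "x \<in> {0, 1}" "t \<in> unit_cube n"
      using \<open>u \<in> unit_cube (Suc n)\<close> by (rule unit_cube_SucE)
    show ?thesis
    proof (cases i)
      case 0
      then show ?thesis
        using u v close [OF TX [OF u(3)]] sym by (auto simp: prism_Cons)
    next
      case (Suc j)
      then have "j < n"
        using i by simp
      then show ?thesis
        using Suc u step [OF cont_f u(3) _ v] step [OF cont_g u(3) _ v]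
        by (simp add: prism_Cons unit_cube_update [OF u(3) v])
    qed
  qed
  moreover have "prism n f g T u \<in> Y" if "u \<in> unit_cube (Suc n)" for u
    using that TY by (elim unit_cube_SucE) (auto simp: prism_Cons)
  moreover have "prism n f g T \<in> extensional (unit_cube (Suc n))"
    by (simp add: prism_def)
  ultimately show ?thesis
    unfolding digital_cubes_iff by blast
qed

lemma prism_degenerate_cubes:
  assumes T: "T \<in> degenerate_cubes (int n) X \<kappa>"
  shows "prism n f g T \<in> degenerate_cubes (int (Suc n)) Y \<mu>"
proof -
  obtain i where i: "i < n"
    and deg: "\<And>t v. t \<in> unit_cube n \<Longrightarrow> v \<in> {0, 1} \<Longrightarrow> T (t[i := v]) = T t"
    using T unfolding degenerate_cubes_iff by blast
  \<comment> \<open>The time variable in front moves the ignored position from \<open>i\<close> to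
    \<open>Suc i\<close>.\<close>
  have "prism n f g T (u[Suc i := v]) = prism n f g T u"
    if "u \<in> unit_cube (Suc n)" and v: "v \<in> {0, 1}" for u v
    using that(1)
  proof (rule unit_cube_SucE)
    fix x t assume "u = x # t" "x \<in> {0, 1}" and t: "t \<in> unit_cube n"
    then show ?thesis
      using unit_cube_update [OF t v] deg [OF t v] by (simp add: prism_Cons)
  qed
  moreover have "prism n f g T \<in> digital_cubes (int (Suc n)) Y \<mu>"
    using T prism_digital_cubes degenerate_cubes_subset by blast
  ultimately show ?thesis
    unfolding degenerate_cubes_iff using i by (meson Suc_mono)
qed

lemma prism_chain_dQ:
  assumes "T \<in> digital_cubes n X \<kappa>"
  shows "frag_of (prism (nat n) f g T) \<in> carrier (dQ (n + 1) Y \<mu>)"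
  using assms digital_cubes_nonneg [OF assms] prism_digital_cubes [of T "nat n"]
  by (simp add: dQ_def keys_frag_of add.commute)

lemma prism_chain_dD:
  assumes T: "T \<in> degenerate_cubes n X \<kappa>"
  shows "frag_of (prism (nat n) f g T) \<in> dD (n + 1) Y \<mu>"
proof -
  have "0 \<le> n"
    using T degenerate_cubes_subset digital_cubes_nonneg by blast
  then have "prism (nat n) f g T \<in> degenerate_cubes (n + 1) Y \<mu>"
    using T prism_degenerate_cubes [of T "nat n"] by (simp add: add.commute)
  then show ?thesis
    by (rule frag_of_degenerate)
qed

lemma prism_chain_hom: "prism_chain n f g \<in> hom (dQ n X \<kappa>) (dQ (n + 1) Y \<mu>)"
  unfolding prism_chain_def by (intro frag_extend_dQ_hom prism_chain_dQ)

lemma prism_chain_image_dD: "prism_chain n f g ` dD n X \<kappa> \<subseteq> dD (n + 1) Y \<mu>"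
  unfolding prism_chain_def by (intro frag_extend_dD prism_chain_dQ prism_chain_dD)

section \<open>Passage to homology\<close>

text \<open>Modulo degenerate chains the homotopy formula loses the prism of the boundary of a
  cycle, and what remains is the boundary of its prism.\<close>

lemma dC_map_cycle:
  assumes z: "z \<in> carrier (dZ n X \<kappa>)"
  shows "\<exists>w\<in>dB n Y \<mu>. dC_map n Y \<mu> g z = dC_map n Y \<mu> f z \<otimes>\<^bsub>dC n Y \<mu>\<^esub> w"
proof -
  let ?D = "dD n Y \<mu>" and ?Q = "dQ n Y \<mu>"
  interpret D: normal ?D ?Q
    by (rule normal_dD)
  obtain c where c: "c \<in> carrier (dQ n X \<kappa>)" and zc: "z = dD n X \<kappa> #>\<^bsub>dQ n X \<kappa>\<^esub> c"
    and cycle: "dC_boundary n X \<kappa> z = dD (n - 1) X \<kappa>"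
    using z by (auto simp: dZ_def kernel_def dC_def carrier_FactGroup)
  have dc: "boundary n c \<in> carrier (dQ (n - 1) X \<kappa>)"
    using hom_in_carrier [OF boundary_hom c] .
  \<comment> \<open>A cycle of \<open>dC\<close> has a representative whose boundary is degenerate
    but may be nonzero in \<open>dQ\<close>; hence prisms must preserve degeneracy.\<close>
  have "boundary n c \<in> dD (n - 1) X \<kappa>"
    using group.coset_join1 [OF group_dQ _ dc subgroup_dD] cycle dC_boundary_coset [OF c] zc by simp
  then have Pdc: "prism_chain (n - 1) f g (boundary n c) \<in> ?D"
    using prism_chain_image_dD [of "n - 1"] by auto
  have Pc: "prism_chain n f g c \<in> carrier (dQ (n + 1) Y \<mu>)"
    using hom_in_carrier [OF prism_chain_hom c] .
  then have dPc: "boundary (n + 1) (prism_chain n f g c) \<in> carrier ?Q"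
    using hom_in_carrier [OF boundary_hom] by fastforce
  have fc: "push_forward n f c \<in> carrier ?Q"
    using hom_in_carrier [OF push_forward_hom [OF cont_f] c] .
  let ?w = "?D #>\<^bsub>?Q\<^esub> boundary (n + 1) (prism_chain n f g c)"
  have "?D #>\<^bsub>?Q\<^esub> (boundary (n + 1) (prism_chain n f g c) \<otimes>\<^bsub>?Q\<^esub> prism_chain (n - 1) f g (boundary n c)) = ?w"
  proof -
    have "?D #>\<^bsub>?Q\<^esub> prism_chain (n - 1) f g (boundary n c) = ?D #>\<^bsub>?Q\<^esub> \<one>\<^bsub>?Q\<^esub>"
      using Pdc D.subgroup_axioms by (simp add: D.coset_join2)
    then show ?thesis
      using D.rcos_sum [OF dPc D.mem_carrier [OF Pdc]] D.rcos_sum [OF dPc, of "\<one>\<^bsub>?Q\<^esub>"] dPc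
      by simp
  qed
  then have "?D #>\<^bsub>?Q\<^esub> push_forward n g c = (?D #>\<^bsub>?Q\<^esub> push_forward n f c) <#>\<^bsub>?Q\<^esub> ?w"
    using prism_chain_homotopy [OF c, of g f] D.rcos_sum [OF fc D.m_closed [OF dPc D.mem_carrier [OF Pdc]]]
    by (simp add: dQ_def)
  then have "dC_map n Y \<mu> g z = dC_map n Y \<mu> f z \<otimes>\<^bsub>dC n Y \<mu>\<^esub> ?w"
    by (simp add: zc dC_map_coset [OF cont_f c] dC_map_coset [OF cont_g c] dC_def)
  moreover have "?w = dC_boundary (n + 1) Y \<mu>
      (dD (n + 1) Y \<mu> #>\<^bsub>dQ (n + 1) Y \<mu>\<^esub> prism_chain n f g c)"
    using dC_boundary_coset [OF Pc] by simp
  then have "?w \<in> dB n Y \<mu>"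
    using Pc by (auto simp: dB_def dC_def carrier_FactGroup)
  ultimately show ?thesis
    by blast
qed

text \<open>Both induced maps apply \<open>the_elem\<close> to a set of cosets, so it suffices that
  each element \<open>x\<close> of a homology class gives the same coset of boundaries under both
  maps.\<close>

lemma dH_map_eq: "dH_map n X \<kappa> Y \<mu> f = dH_map n X \<kappa> Y \<mu> g"
proof -
  let ?F = "dC_map n Y \<mu> f" and ?G = "dC_map n Y \<mu> g" and ?B = "dB n Y \<mu>"
  interpret C: comm_group "dC n X \<kappa>"
    by (rule comm_group_dC)
  interpret C': comm_group "dC n Y \<mu>"
    by (rule comm_group_dC)
  interpret B: subgroup "dB n X \<kappa>" "dC n X \<kappa>"
    by (rule subgroup_dB)
  interpret B': subgroup ?B "dC n Y \<mu>"
    by (rule subgroup_dB)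
  interpret F: group_hom "dC n X \<kappa>" "dC n Y \<mu>" ?F
    using dC_map_hom [OF cont_f] by unfold_locales simp
  interpret G: group_hom "dC n X \<kappa>" "dC n Y \<mu>" ?G
    using dC_map_hom [OF cont_g] by unfold_locales simp
  \<comment> \<open>\<open>dZ\<close> differs from \<open>dC\<close> only in its carrier, which a
    coset does not see; the comparison can thus be made in \<open>dC\<close>.\<close>
  have coset: "?B #>\<^bsub>dZ n Y \<mu>\<^esub> a = ?B #>\<^bsub>dC n Y \<mu>\<^esub> a" for a
    by (simp add: r_coset_def dZ_def)
  have "?B #>\<^bsub>dC n Y \<mu>\<^esub> ?F x = ?B #>\<^bsub>dC n Y \<mu>\<^esub> ?G x"
    if C: "C \<in> carrier (dH n X \<kappa>)" "x \<in> C" for C x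
  proof -
    \<comment> \<open>Comparing \<open>f\<^sub>#\<close> and \<open>g\<^sub>#\<close> on \<open>b\<close> and \<open>z\<close> separately makes \<open>\<partial>\<partial> = 0\<close> unnecessary.\<close>
    obtain z b where z: "z \<in> carrier (dZ n X \<kappa>)" and b: "b \<in> dB n X \<kappa>"
      and x: "x = b \<otimes>\<^bsub>dC n X \<kappa>\<^esub> z"
      using C by (auto simp: dH_def carrier_FactGroup r_coset_def dZ_def)
    have zC: "z \<in> carrier (dC n X \<kappa>)" and bC: "b \<in> carrier (dC n X \<kappa>)"
      using z b by (auto simp: dZ_def kernel_def)
    obtain w where w: "w \<in> ?B" "?G z = ?F z \<otimes>\<^bsub>dC n Y \<mu>\<^esub> w"
      using dC_map_cycle [OF z] by blast
    \<comment> \<open>The total discrepancy at \<open>x\<close>: the part from \<open>b\<close> is a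
      quotient of two boundaries, since chain maps preserve boundaries, and \<open>w\<close> is the
      part from \<open>z\<close>.\<close>
    define w' where "w' = ?G b \<otimes>\<^bsub>dC n Y \<mu>\<^esub> inv\<^bsub>dC n Y \<mu>\<^esub> ?F b \<otimes>\<^bsub>dC n Y \<mu>\<^esub> w"
    have "w' \<in> ?B"
      unfolding w'_def using w(1) dC_map_dB [OF cont_f b] dC_map_dB [OF cont_g b] by simp
    moreover have "?G x = w' \<otimes>\<^bsub>dC n Y \<mu>\<^esub> ?F x"
    proof -
      have "w' \<otimes>\<^bsub>dC n Y \<mu>\<^esub> ?F x = ?G b \<otimes>\<^bsub>dC n Y \<mu>\<^esub> (?F z \<otimes>\<^bsub>dC n Y \<mu>\<^esub> w) \<otimes>\<^bsub>dC n Y \<mu>\<^esub> (inv\<^bsub>dC n Y \<mu>\<^esub> ?F b \<otimes>\<^bsub>dC n Y \<mu>\<^esub> ?F b)"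
        using bC zC w(1)
        by (simp add: w'_def x C'.m_ac del: C'.l_inv C'.r_inv C'.Units_l_inv C'.Units_r_inv)
      then show ?thesis
        using bC zC w by (simp add: x)
    qed
    ultimately have "?G x \<in> ?B #>\<^bsub>dC n Y \<mu>\<^esub> ?F x"
      by (auto simp: r_coset_def)
    then show ?thesis
      using bC zC by (intro C'.repr_independence B'.subgroup_axioms) (simp_all add: x)
  qed
  then show ?thesis
    unfolding dH_map_def quotient_map_def coset
    by (intro restrict_ext arg_cong [where f = the_elem] image_cong) auto
qed

end

section \<open>Chaining the time steps\<close>

lemma line_adj_Suc: "line_adj k (k + 1)"
proof -
  have "{i. i < (1::nat) \<and> \<bar>[k] ! i - [k + 1] ! i\<bar> = 1} = {0}"
    by auto
  then show ?thesis
    by (simp add: line_adj_def c_adj_def int_lattice_def)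
qed

theorem theorem3p7:
  fixes X Y :: "int list set"
    and \<kappa> \<mu> :: "int list \<Rightarrow> int list \<Rightarrow> bool"
    and f g :: "int list \<Rightarrow> int list"
    and n :: int
  assumes "digital_image X \<kappa>"
    and "digital_image Y \<mu>"
    and "digital_homotopic X \<kappa> Y \<mu> f g"
  shows "dH_map n X \<kappa> Y \<mu> f = dH_map n X \<kappa> Y \<mu> g"
proof -
  have sym: "\<mu> p q \<Longrightarrow> \<mu> q p" for p q
    using assms(2) c_adj_sym unfolding digital_image_def by blast
  obtain m H where f: "digital_continuous X \<kappa> Y \<mu> f" and g: "digital_continuous X \<kappa> Y \<mu> g"
    and "m > 0" and H0: "\<forall>x\<in>X. H (0, x) = f x" and Hm: "\<forall>x\<in>X. H (m, x) = g x"
    and Hx: "\<forall>x\<in>X. digital_continuous {0..m} line_adj Y \<mu> (\<lambda>t. H (t, x))"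
    and Ht: "\<forall>t\<in>{0..m}. digital_continuous X \<kappa> Y \<mu> (\<lambda>x. H (t, x))"
    using assms(3) unfolding digital_homotopic_def by blast
  \<comment> \<open>Induction on time: consecutive slices of \<open>H\<close> form a
    \<open>homotopy_step\<close>, because each track in time is continuous.\<close>
  have eq: "dH_map n X \<kappa> Y \<mu> f = dH_map n X \<kappa> Y \<mu> (\<lambda>x. H (int k, x))" if "int k \<le> m" for k
    using that
  proof (induction k)
    case 0
    \<comment> \<open>The slice at time 0 agrees with \<open>f\<close> on \<open>X\<close> only, so
      the two are compared by a step in which nothing moves on \<open>X\<close>.\<close>
    interpret homotopy_step X \<kappa> Y \<mu> f "\<lambda>x. H (int 0, x)"
      using f Ht H0 \<open>m > 0\<close> sym by unfold_locales auto
    show ?case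
      by (rule dH_map_eq)
  next
    case (Suc k)
    have "H (int k, x) = H (int k + 1, x) \<or> \<mu> (H (int k, x)) (H (int k + 1, x))" if "x \<in> X" for x
      using Hx Suc.prems that line_adj_Suc [of "int k"] unfolding digital_continuous_def by auto
    then interpret homotopy_step X \<kappa> Y \<mu> "\<lambda>x. H (int k, x)" "\<lambda>x. H (int (Suc k), x)"
      using Ht Suc.prems sym by unfold_locales (auto simp: add.commute)
    show ?case
      using Suc dH_map_eq by simp
  qed
  \<comment> \<open>The same device at the far end, where the last slice equals \<open>g\<close> on
    \<open>X\<close>.\<close>
  interpret homotopy_step X \<kappa> Y \<mu> "\<lambda>x. H (m, x)" g
    using g Ht Hm \<open>m > 0\<close> sym by unfold_locales auto
  show ?thesis
    using eq [of "nat m"] \<open>m > 0\<close> dH_map_eq by simp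
qed

end
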